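(* Let $\gamma$ and $n$ be integers with $0<\gamma\leq n$, and let $\theta\in\mathbb{R}$. Then $$Hl\left(\tfrac12,2n\theta;2n,2\theta;\gamma,\gamma;x\right)=(1-2x)^{-2(n-\gamma+\theta)}\sum_{k=0}^{n-\gamma}4^k\binom{n-\gamma}{k}\frac{(\gamma-\theta)_k}{(\gamma)_k}(x^2-x)^k .$$
   Context: For parameters with $a\notin\{0,1\}$, $\gamma\notin\{0,-1,-2,\dots\}$, and $\epsilon$ determined by $\alpha+\beta+1=\gamma+\delta+\epsilon$, the (local) Heun function $Hl(a,q;\alpha,\beta;\gamma,\delta;x)$ is the solution $u(x)$, analytic at $x=0$ and normalized by $u(0)=1$, of the general Heun equation $$u''(x)+\left(\frac{\gamma}{x}+\frac{\delta}{x-1}+\frac{\epsilon}{x-a}\right)u'(x)+\frac{\alpha\beta x-q}{x(x-1)(x-a)}u(x)=0 .$$ The identity is understood for $x$ near $0$, with the branch of the power equal to $1$ at $x=0$. For an integer $k\ge 0$ and a number $r$, $(r)_k:=r(r+1)\cdots(r+k-1)$ if $k>0$, and $(r)_0:=1$. *)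

theory Defs
  imports "HOL-Complex_Analysis.Complex_Analysis"
begin

text \<open>
  The general Heun equation at the point \<open>x\<close>, with \<open>\<epsilon>\<close> eliminated by the Fuchs relation
  \<open>\<alpha> + \<beta> + 1 = \<gamma> + \<delta> + \<epsilon>\<close>. It is meaningful only for \<open>x\<close> different from the finite
  singularities \<open>0\<close>, \<open>1\<close>, \<open>a\<close>.
\<close>

definition heun_equation ::
  "complex \<Rightarrow> complex \<Rightarrow> complex \<Rightarrow> complex \<Rightarrow> complex \<Rightarrow> complex \<Rightarrow>
     (complex \<Rightarrow> complex) \<Rightarrow> complex \<Rightarrow> bool" where
  "heun_equation a q \<alpha> \<beta> \<gamma> \<delta> u x \<longleftrightarrow>
     (let \<epsilon> = \<alpha> + \<beta> + 1 - \<gamma> - \<delta> in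
        deriv (deriv u) x
          + (\<gamma> / x + \<delta> / (x - 1) + \<epsilon> / (x - a)) * deriv u x
          + (\<alpha> * \<beta> * x - q) / (x * (x - 1) * (x - a)) * u x = 0)"

text \<open>
  The local Heun function. A solution that is analytic at \<open>0\<close> extends to the largest disc around
  \<open>0\<close> that avoids \<open>1\<close> and \<open>a\<close>, and \<open>Hl\<close> is taken on that disc; outside it, the value \<open>0\<close> is a
  dummy that makes the description unique as a total function. As usual, the description is only
  meaningful for \<open>a \<notin> {0, 1}\<close> and \<open>\<gamma>\<close> not in \<open>{0, -1, -2, \<dots>}\<close>.
\<close>

definition Hl ::
  "complex \<Rightarrow> complex \<Rightarrow> complex \<Rightarrow> complex \<Rightarrow> complex \<Rightarrow> complex \<Rightarrow> complex \<Rightarrow> complex" where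
  "Hl a q \<alpha> \<beta> \<gamma> \<delta> =
     (THE u. let D = ball 0 (min 1 (norm a)) in
        u holomorphic_on D \<and> u 0 = 1 \<and>
        (\<forall>x \<in> D - {0}. heun_equation a q \<alpha> \<beta> \<gamma> \<delta> u x) \<and>
        (\<forall>x. x \<notin> D \<longrightarrow> u x = 0))"

end

theory Submission
  imports Defs
begin

text \<open>
  For these parameters the term \<open>\<alpha> \<beta> x - q\<close> is a multiple of \<open>x - 1/2\<close>, so the singularity of the
  last coefficient at \<open>a = 1/2\<close> cancels, and the equation is symmetric under \<open>x \<mapsto> 1 - x\<close>. It is
  therefore the pullback along \<open>z = 4 x (1 - x)\<close> of a hypergeometric equation, namely that of
  \<open>F(n, \<theta>; \<gamma>; z)\<close>. Euler's transformation rewrites this function as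
  \<open>(1 - z)\<^bsup>\<gamma> - n - \<theta>\<^esup> F(\<gamma> - n, \<gamma> - \<theta>; \<gamma>; z)\<close>, where \<open>1 - z = (1 - 2 x)\<^sup>2\<close>, and the second factor
  is a polynomial because \<open>\<gamma> - n\<close> is an integer that is not positive.

  The proof verifies the outcome directly. With \<open>w = x\<^sup>2 - x = -z/4\<close>, the polynomial factor solves
  its own hypergeometric equation in \<open>w\<close> (lemma \<open>heun_factor_ode\<close>, by comparing coefficients),
  and hence its product with the power of \<open>1 - 2 x\<close> solves the Heun equation on the disc of
  radius \<open>1/2\<close> (lemma \<open>heun_equation_symmetric\<close>). It remains to know that a solution that is
  holomorphic at \<open>0\<close> is determined by its value there (lemma \<open>heun_solution_eq_0\<close>): a zero of order
  \<open>k > 0\<close> at \<open>0\<close> would make \<open>k\<close> a root of the indicial polynomial \<open>k (k - 1 + \<gamma>)\<close>.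
\<close>

section \<open>Uniqueness of the local solution\<close>

lemma deriv_power_mult:
  fixes f g :: "complex \<Rightarrow> complex"
  assumes S: "open S" "x \<in> S" "x \<noteq> 0" and g: "g holomorphic_on S"
    and f: "\<And>y. y \<in> S \<Longrightarrow> f y = y ^ k * g y"
  shows "x * deriv f x = x ^ k * (of_nat k * g x + x * deriv g x)"
proof -
  have ev: "eventually (\<lambda>y. f y = y ^ k * g y) (nhds x)"
    using S f by (auto simp: eventually_nhds)
  have "(g has_field_derivative deriv g x) (at x)"
    using g S by (auto intro: holomorphic_derivI)
  then have "((\<lambda>y. y ^ k * g y) has_field_derivative
      (x ^ k * deriv g x + of_nat k * x ^ (k - 1) * g x)) (at x)"
    by (auto intro!: derivative_eq_intros)
  then have "deriv f x = x ^ k * deriv g x + of_nat k * x ^ (k - 1) * g x"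
    by (simp add: deriv_cong_ev[OF ev refl] DERIV_imp_deriv)
  then show ?thesis
    by (cases k) (auto simp: algebra_simps)
qed

text \<open>
  The local exponents at a regular singular point: a function \<open>v\<close> with a zero of order \<open>k > 0\<close> at
  \<open>0\<close> has \<open>x v'' + p v' + r v = x\<^bsup>k - 1\<^esup> (k (k - 1 + p(0)) g(0) + o(1))\<close>, where \<open>v = x\<^sup>k g\<close>.
\<close>

lemma regular_singular_solution_eq_0:
  fixes v p r :: "complex \<Rightarrow> complex"
  assumes D: "open D" "connected D" "0 \<in> D" and v: "v holomorphic_on D" "v 0 = 0"
    and p: "continuous_on D p" and r: "continuous_on D r"
    and ode: "\<And>x. x \<in> D - {0} \<Longrightarrow> x * deriv (deriv v) x + p x * deriv v x + r x * v x = 0"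
    and indicial: "\<And>k::nat. p 0 \<noteq> - of_nat k"
    and x: "x \<in> D"
  shows "v x = 0"
proof (rule ccontr)
  assume "v x \<noteq> 0"
  then have "\<not> v constant_on D"
    using v x D unfolding constant_on_def by metis
  with holomorphic_factor_zero_nonconstant[OF v(1) D v(2)]
  obtain g e k where k: "0 < (k::nat)" and e: "0 < e" "ball 0 e \<subseteq> D"
    and g: "g holomorphic_on ball 0 e"
    and vg: "\<And>w. w \<in> ball 0 e \<Longrightarrow> v w = (w - 0) ^ k * g w"
    and g0: "\<And>w. w \<in> ball 0 e \<Longrightarrow> g w \<noteq> 0"
    by metis
  define h where "h y = of_nat k * g y + y * deriv g y" for y
  have g': "deriv g holomorphic_on ball 0 e"
    using g by (rule holomorphic_deriv) simp
  have h: "h holomorphic_on ball 0 e"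
    unfolding h_def by (intro holomorphic_intros g g')
  have h': "deriv h holomorphic_on ball 0 e"
    using h by (rule holomorphic_deriv) simp
  have dv: "y * deriv v y = y ^ k * h y" if "y \<in> ball 0 e" "y \<noteq> 0" for y
    unfolding h_def by (rule deriv_power_mult[OF _ that g]) (use vg in auto)
  \<comment> \<open>The left-hand side of the equation at \<open>y\<close> is \<open>y\<^bsup>k - 1\<^esup> B(y)\<close>, so \<open>B\<close> vanishes off \<open>0\<close> and, being
    continuous, at \<open>0\<close> as well, where it is \<open>k (k - 1 + p(0)) g(0)\<close>.\<close>
  define B where "B y = (of_nat k - 1) * h y + y * deriv h y + p y * h y + r y * (y * g y)" for y
  have B_zero: "B y = 0" if y: "y \<in> ball 0 e - {0}" for y
  proof -
    have "open (ball 0 e - {0::complex})" by (intro open_delete) simp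
    \<comment> \<open>The rule for \<open>x\<^sup>k g\<close> again, now for \<open>x v' = x\<^sup>k h\<close>.\<close>
    then have 1: "y * deriv (\<lambda>y. y * deriv v y) y = y ^ k * (of_nat k * h y + y * deriv h y)"
      using y by (intro deriv_power_mult[where S = "ball 0 e - {0}"])
        (auto intro: holomorphic_on_subset[OF h] dv)
    have yD: "y \<in> D" using y e by auto
    have "deriv v holomorphic_on D"
      using v(1) D(1) by (rule holomorphic_deriv)
    then have "(deriv v has_field_derivative deriv (deriv v) y) (at y)"
      using D(1) yD by (rule holomorphic_derivI)
    then have "((\<lambda>y. y * deriv v y) has_field_derivative
        (y * deriv (deriv v) y + deriv v y)) (at y)"
      by (auto intro!: derivative_eq_intros)
    then have 2: "deriv (\<lambda>y. y * deriv v y) y = y * deriv (deriv v) y + deriv v y"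
      by (rule DERIV_imp_deriv)
    have 3: "y * deriv v y = y ^ k * h y" "v y = y ^ k * g y"
      using dv[of y] vg[of y] y by auto
    have "0 = y * (y * deriv (deriv v) y + p y * deriv v y + r y * v y)"
      using ode[of y] yD y by simp
    also have "\<dots> = y * (y * deriv (deriv v) y + deriv v y) - y * deriv v y
        + p y * (y * deriv v y) + r y * (y * v y)"
      by (simp add: algebra_simps)
    also have "\<dots> = y ^ k * B y"
      using 1 unfolding 2 3 B_def by (simp add: algebra_simps)
    finally show ?thesis using y by simp
  qed
  have "continuous_on (ball 0 e) B"
    unfolding B_def
    by (intro continuous_intros holomorphic_on_imp_continuous_on[OF h]
        holomorphic_on_imp_continuous_on[OF h'] holomorphic_on_imp_continuous_on[OF g]
        continuous_on_subset[OF p] continuous_on_subset[OF r] e)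
  then have "isCont B 0"
    using e by (simp add: continuous_on_eq_continuous_at)
  then have "(B \<longlongrightarrow> B 0) (at 0)"
    by (simp add: isCont_def)
  moreover have "(B \<longlongrightarrow> 0) (at 0)"
  proof (rule tendsto_eventually)
    have "eventually (\<lambda>y. y \<in> ball 0 e - {0}) (at (0::complex))"
      using e by (intro eventually_at_in_open) auto
    then show "eventually (\<lambda>y. B y = 0) (at 0)"
      by eventually_elim (rule B_zero)
  qed
  ultimately have "B 0 = 0"
    by (rule tendsto_unique[rotated]) simp
  then have "(of_nat k - 1 + p 0) * (of_nat k * g 0) = 0"
    by (simp add: B_def h_def algebra_simps)
  moreover have "of_nat k * g 0 \<noteq> 0"
    using k g0[of 0] e by auto
  ultimately have "of_nat k - 1 + p 0 = 0"
    by (metis mult_eq_0_iff)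
  then have "p 0 = 1 - of_nat k"
    by (simp add: algebra_simps)
  also have "\<dots> = - of_nat (k - 1)"
    using k by (simp add: of_nat_diff)
  finally show False using indicial by blast
qed

lemma heun_solution_eq_0:
  fixes v :: "complex \<Rightarrow> complex"
  assumes a: "a \<noteq> 0" and \<gamma>: "\<And>k::nat. \<gamma> \<noteq> - of_nat k"
    and v: "v holomorphic_on ball 0 (min 1 (norm a))" "v 0 = 0"
    and ode: "\<And>x. x \<in> ball 0 (min 1 (norm a)) - {0} \<Longrightarrow> heun_equation a q \<alpha> \<beta> \<gamma> \<delta> v x"
    and x: "x \<in> ball 0 (min 1 (norm a))"
  shows "v x = 0"
proof -
  define p where "p y = \<gamma> + y * (\<delta> / (y - 1) + (\<alpha> + \<beta> + 1 - \<gamma> - \<delta>) / (y - a))" for y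
  define r where "r y = (\<alpha> * \<beta> * y - q) / ((y - 1) * (y - a))" for y
  have nz: "y - 1 \<noteq> 0" "y - a \<noteq> 0" if "y \<in> ball 0 (min 1 (norm a))" for y
    using that by auto
  show ?thesis
  proof (rule regular_singular_solution_eq_0[OF _ _ _ v _ _ _ _ x])
    show "continuous_on (ball 0 (min 1 (norm a))) p" "continuous_on (ball 0 (min 1 (norm a))) r"
      unfolding p_def r_def by (intro continuous_intros; use nz in auto)+
    show "p 0 \<noteq> - of_nat k" for k using \<gamma>[of k] by (simp add: p_def)
    show "y * deriv (deriv v) y + p y * deriv v y + r y * v y = 0"
      if "y \<in> ball 0 (min 1 (norm a)) - {0}" for y
    proof -
      have [simp]: "y \<noteq> 0" "y - 1 \<noteq> 0" "y - a \<noteq> 0" using that nz by blast+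
      have "0 = y * (deriv (deriv v) y
          + (\<gamma> / y + \<delta> / (y - 1) + (\<alpha> + \<beta> + 1 - \<gamma> - \<delta>) / (y - a)) * deriv v y
          + (\<alpha> * \<beta> * y - q) / (y * (y - 1) * (y - a)) * v y)"
        using ode[OF that] unfolding heun_equation_def Let_def by simp
      also have "\<dots> = y * deriv (deriv v) y
          + y * (\<gamma> / y + (\<delta> / (y - 1) + (\<alpha> + \<beta> + 1 - \<gamma> - \<delta>) / (y - a))) * deriv v y
          + y * ((\<alpha> * \<beta> * y - q) / (y * ((y - 1) * (y - a)))) * v y"
        by (simp only: distrib_left distrib_right mult.assoc add.assoc)
      also have "y * (\<gamma> / y + (\<delta> / (y - 1) + (\<alpha> + \<beta> + 1 - \<gamma> - \<delta>) / (y - a))) = p y"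
        unfolding p_def distrib_left by simp
      also have "y * ((\<alpha> * \<beta> * y - q) / (y * ((y - 1) * (y - a)))) = r y"
        unfolding r_def by simp
      finally show ?thesis by simp
    qed
  qed (use a in auto)
qed

lemma heun_equation_cong:
  assumes "open S" "x \<in> S" "\<And>y. y \<in> S \<Longrightarrow> u y = v y"
  shows "heun_equation a q \<alpha> \<beta> \<gamma> \<delta> u x \<longleftrightarrow> heun_equation a q \<alpha> \<beta> \<gamma> \<delta> v x"
proof -
  have d: "deriv u y = deriv v y" if "y \<in> S" for y
    using assms that by (intro deriv_cong_ev) (auto simp: eventually_nhds)
  have "deriv (deriv u) x = deriv (deriv v) x"
    using assms d by (intro deriv_cong_ev) (auto simp: eventually_nhds)
  then show ?thesis
    using assms d unfolding heun_equation_def by simp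
qed

lemma heun_equation_diff:
  assumes S: "open S" "x \<in> S" and u: "u holomorphic_on S" and v: "v holomorphic_on S"
    and "heun_equation a q \<alpha> \<beta> \<gamma> \<delta> u x" "heun_equation a q \<alpha> \<beta> \<gamma> \<delta> v x"
  shows "heun_equation a q \<alpha> \<beta> \<gamma> \<delta> (\<lambda>y. u y - v y) x"
proof -
  have d: "deriv (\<lambda>y. u y - v y) y = deriv u y - deriv v y" if "y \<in> S" for y
    using S u v that by (intro deriv_diff) (auto simp: holomorphic_on_open field_differentiable_def)
  have "deriv (deriv (\<lambda>y. u y - v y)) x = deriv (\<lambda>y. deriv u y - deriv v y) x"
    using S d by (intro deriv_cong_ev) (auto simp: eventually_nhds)
  also have "\<dots> = deriv (deriv u) x - deriv (deriv v) x"
    using S holomorphic_deriv[OF u] holomorphic_deriv[OF v]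
    by (intro deriv_diff) (auto simp: holomorphic_on_open field_differentiable_def)
  finally have dd: "deriv (deriv (\<lambda>y. u y - v y)) x = deriv (deriv u) x - deriv (deriv v) x" .
  have linear: "(r - r') + b * (s - s') + c * (t - t') = 0"
    if "r + b * s + c * t = 0" "r' + b * s' + c * t' = 0" for b c r r' s s' t t' :: complex
  proof -
    have "(r - r') + b * (s - s') + c * (t - t') = (r + b * s + c * t) - (r' + b * s' + c * t')"
      by (simp add: algebra_simps)
    with that show ?thesis by simp
  qed
  show ?thesis
    using assms(5,6) unfolding heun_equation_def Let_def dd d[OF S(2)] by (rule linear)
qed

lemma Hl_eqI:
  assumes a: "a \<noteq> 0" and \<gamma>: "\<And>k::nat. \<gamma> \<noteq> - of_nat k"
    and u: "u holomorphic_on ball 0 (min 1 (norm a))" "u 0 = 1"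
    and ode: "\<And>x. x \<in> ball 0 (min 1 (norm a)) - {0} \<Longrightarrow> heun_equation a q \<alpha> \<beta> \<gamma> \<delta> u x"
    and x: "x \<in> ball 0 (min 1 (norm a))"
  shows "Hl a q \<alpha> \<beta> \<gamma> \<delta> x = u x"
proof -
  define D where "D = ball (0::complex) (min 1 (norm a))"
  define U where "U y = (if y \<in> D then u y else 0)" for y
  have D: "open D" "0 \<in> D" using a by (auto simp: D_def)
  have Uhol: "U holomorphic_on D"
    by (rule holomorphic_transform[OF u(1)[folded D_def]]) (simp add: U_def)
  have Uode: "heun_equation a q \<alpha> \<beta> \<gamma> \<delta> U y" if "y \<in> D - {0}" for y
    using ode[folded D_def, OF that] heun_equation_cong[of D y U u] D that by (simp add: U_def)
  have "Hl a q \<alpha> \<beta> \<gamma> \<delta> = U"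
    unfolding Hl_def Let_def D_def[symmetric]
  proof (rule the_equality)
    show "U holomorphic_on D \<and> U 0 = 1 \<and> (\<forall>y\<in>D - {0}. heun_equation a q \<alpha> \<beta> \<gamma> \<delta> U y)
        \<and> (\<forall>y. y \<notin> D \<longrightarrow> U y = 0)"
      using Uhol Uode u D by (auto simp: U_def)
  next
    fix V
    assume V: "V holomorphic_on D \<and> V 0 = 1 \<and> (\<forall>y\<in>D - {0}. heun_equation a q \<alpha> \<beta> \<gamma> \<delta> V y)
        \<and> (\<forall>y. y \<notin> D \<longrightarrow> V y = 0)"
    show "V = U"
    proof
      fix y
      show "V y = U y"
      proof (cases "y \<in> D")
        case True
        have "V y - U y = 0"
        proof (rule heun_solution_eq_0[where v = "\<lambda>y. V y - U y", OF a \<gamma>, folded D_def])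
          show "(\<lambda>y. V y - U y) holomorphic_on D"
            using V Uhol by (intro holomorphic_intros) auto
          show "V 0 - U 0 = 0" using V u D by (simp add: U_def)
          show "heun_equation a q \<alpha> \<beta> \<gamma> \<delta> (\<lambda>y. V y - U y) z" if "z \<in> D - {0}" for z
            using that V Uhol Uode D by (intro heun_equation_diff[of D]) auto
        qed (rule True)
        then show ?thesis by simp
      qed (use V in \<open>simp add: U_def\<close>)
    qed
  qed
  then show ?thesis using x by (simp add: U_def D_def)
qed

section \<open>The polynomial factor\<close>

text \<open>
  The polynomial \<open>F(-m, b; c; -4 w)\<close> in the variable \<open>w\<close>, for \<open>c\<close> not in \<open>{0, -1, -2, \<dots>}\<close>; the
  signs of \<open>(-m)\<^sub>k / k!\<close> and \<open>(-4)\<^sup>k\<close> cancel.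
\<close>

definition heun_factor :: "nat \<Rightarrow> complex \<Rightarrow> complex \<Rightarrow> complex poly" where
  "heun_factor m b c =
     (\<Sum>k = 0..m. monom (4 ^ k * of_nat (m choose k) * (pochhammer b k / pochhammer c k)) k)"

lemma coeff_heun_factor:
  "coeff (heun_factor m b c) k = 4 ^ k * of_nat (m choose k) * (pochhammer b k / pochhammer c k)"
  by (cases "k \<le> m") (auto simp: heun_factor_def coeff_sum sum.delta binomial_eq_0)

lemma poly_heun_factor:
  "poly (heun_factor m b c) w =
     (\<Sum>k = 0..m. 4 ^ k * of_nat (m choose k) * (pochhammer b k / pochhammer c k) * w ^ k)"
  by (simp add: heun_factor_def poly_sum poly_monom)

lemma coeff_heun_factor_Suc:
  assumes c: "\<And>k::nat. c \<noteq> - of_nat k"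
  shows "of_nat (Suc k) * (of_nat k + c) * coeff (heun_factor m b c) (Suc k) =
    4 * (of_nat m - of_nat k) * (of_nat k + b) * coeff (heun_factor m b c) k"
proof -
  have "Suc k * (m choose Suc k) = (m - k) * (m choose k)"
    by (metis binomial_absorb_comp binomial_absorption mult.commute)
  then have "of_nat (Suc k) * of_nat (m choose Suc k) = (of_nat (m - k) * of_nat (m choose k) :: complex)"
    by (metis of_nat_mult)
  also have "\<dots> = (of_nat m - of_nat k) * of_nat (m choose k)"
    by (cases "k \<le> m") (auto simp: of_nat_diff binomial_eq_0)
  finally have 1: "of_nat (Suc k) * of_nat (m choose Suc k)
      = ((of_nat m - of_nat k) * of_nat (m choose k) :: complex)" .
  have ck: "of_nat k + c \<noteq> 0"
    using c[of k] by (auto simp: add_eq_0_iff)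
  have "of_nat (Suc k) * (of_nat k + c) * coeff (heun_factor m b c) (Suc k)
      = (of_nat (Suc k) * of_nat (m choose Suc k)) * (4 * 4 ^ k)
        * ((of_nat k + c) * (pochhammer b k * (b + of_nat k)
            / (pochhammer c k * (c + of_nat k))))"
    by (simp only: coeff_heun_factor pochhammer_Suc power_Suc ac_simps)
  also have "(of_nat k + c) * (pochhammer b k * (b + of_nat k) / (pochhammer c k * (c + of_nat k)))
      = (b + of_nat k) * (pochhammer b k / pochhammer c k)"
    using ck by (simp add: add.commute)
  finally show ?thesis
    unfolding 1 coeff_heun_factor by (simp add: ac_simps)
qed

text \<open>
  The hypergeometric equation \<open>z (1 - z) f'' + (c - (b - m + 1) z) f' + m b f = 0\<close>, rewritten in
  \<open>w = -z/4\<close>.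
\<close>

lemma heun_factor_ode:
  fixes b c w :: complex and m :: nat
  assumes c: "\<And>k::nat. c \<noteq> - of_nat k"
  defines "P \<equiv> heun_factor m b c"
  shows "w * (1 + 4 * w) * poly (pderiv (pderiv P)) w
      + (c + 4 * (b - of_nat m + 1) * w) * poly (pderiv P) w
      - 4 * of_nat m * b * poly P w = 0"
proof -
  have "[:0, 1, 4:] * pderiv (pderiv P) + [:c, 4 * (b - of_nat m + 1):] * pderiv P
      + smult (- 4 * of_nat m * b) P = 0"
  proof (rule poly_eqI)
    fix k
    have rec: "of_nat (Suc k) * (of_nat k + c) * coeff P (Suc k) =
        4 * (of_nat m - of_nat k) * (of_nat k + b) * coeff P k"
      unfolding P_def by (rule coeff_heun_factor_Suc[OF c])
    consider "k = 0" | "k = Suc 0" | l where "k = Suc (Suc l)"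
      by (cases k; cases "k - 1") auto
    then show "coeff ([:0, 1, 4:] * pderiv (pderiv P) + [:c, 4 * (b - of_nat m + 1):] * pderiv P
      + smult (- 4 * of_nat m * b) P) k = coeff 0 k"
      using rec by cases (simp_all add: coeff_pderiv; simp add: algebra_simps)+
  qed
  then have "poly ([:0, 1, 4:] * pderiv (pderiv P) + [:c, 4 * (b - of_nat m + 1):] * pderiv P
      + smult (- 4 * of_nat m * b) P) w = 0"
    by simp
  then show ?thesis
    by (simp add: algebra_simps)
qed

section \<open>The explicit solution\<close>

lemma one_minus_double_nonpos:
  assumes "x \<in> ball (0::complex) (1 / 2)"
  shows "1 - 2 * x \<notin> \<real>\<^sub>\<le>\<^sub>0"
proof -
  have "Re x < 1 / 2"
    using assms complex_Re_le_cmod[of x] by simp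
  then show ?thesis
    by (auto simp: complex_nonpos_Reals_iff)
qed

text \<open>
  Here \<open>\<gamma>\<close> and \<open>\<theta>\<close> may be complex; only \<open>m = n - \<gamma>\<close> has to be a natural number. With
  \<open>s = m + \<theta>\<close> and \<open>h = 1 - 2 x\<close>, the Heun equation for \<open>h\<^bsup>-2s\<^esup> P(w)\<close>, divided by \<open>h\<^bsup>-2s\<^esup>\<close> and multiplied
  by \<open>w\<close>, becomes the equation of \<open>heun_factor_ode\<close> for \<open>P\<close>, because \<open>h\<^sup>2 = 1 + 4 w\<close>.
\<close>

lemma heun_equation_symmetric:
  fixes \<gamma> \<theta> :: complex
  assumes \<gamma>: "\<And>k::nat. \<gamma> \<noteq> - of_nat k"
    and x: "x \<in> ball 0 (1 / 2) - {0}"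
  shows "heun_equation (1 / 2) (2 * (\<gamma> + of_nat m) * \<theta>) (2 * (\<gamma> + of_nat m)) (2 * \<theta>) \<gamma> \<gamma>
    (\<lambda>x. (1 - 2 * x) powr (- 2 * (of_nat m + \<theta>)) * poly (heun_factor m (\<gamma> - \<theta>) \<gamma>) (x\<^sup>2 - x)) x"
proof -
  define s where "s = of_nat m + \<theta>"
  define P where "P = heun_factor m (\<gamma> - \<theta>) \<gamma>"
  define u where "u x = (1 - 2 * x) powr (- 2 * s) * poly P (x\<^sup>2 - x)" for x
  have nz: "1 - 2 * y \<noteq> 0" if "y \<in> ball 0 (1 / 2)" for y :: complex
    using one_minus_double_nonpos[OF that] by auto
  have pow: "((\<lambda>y. (1 - 2 * y) powr (- 2 * s)) has_field_derivative
      (1 - 2 * y) powr (- 2 * s) * (4 * s / (1 - 2 * y))) (at y)"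
    if "y \<in> ball 0 (1 / 2)" for y
    using one_minus_double_nonpos[OF that] nz[OF that]
    by (auto intro!: derivative_eq_intros simp: powr_diff)
  have pol: "((\<lambda>y. poly Q (y\<^sup>2 - y)) has_field_derivative
      - (1 - 2 * y) * poly (pderiv Q) (y\<^sup>2 - y)) (at y)" for Q y
    by (rule DERIV_cong[OF DERIV_chain2[OF poly_DERIV]])
      (auto intro!: derivative_eq_intros simp: algebra_simps)
  define v where "v y = 4 * s / (1 - 2 * y) * poly P (y\<^sup>2 - y)
      - (1 - 2 * y) * poly (pderiv P) (y\<^sup>2 - y)" for y
  have du: "deriv u y = (1 - 2 * y) powr (- 2 * s) * v y" if y: "y \<in> ball 0 (1 / 2)" for y
  proof (rule DERIV_imp_deriv)
    show "(u has_field_derivative (1 - 2 * y) powr (- 2 * s) * v y) (at y)"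
      unfolding u_def v_def
      by (rule DERIV_cong[OF DERIV_mult[OF pow[OF y] pol]]) (simp add: algebra_simps)
  qed
  have x': "x \<in> ball 0 (1 / 2)" using x by simp
  define h where "h = 1 - 2 * x"
  define w where "w = x\<^sup>2 - x"
  define E where "E = h powr (- 2 * s)"
  have h0: "h \<noteq> 0" using nz[OF x'] by (simp add: h_def)
  have dv: "(v has_field_derivative
      8 * s / h\<^sup>2 * poly P w - (4 * s - 2) * poly (pderiv P) w + h\<^sup>2 * poly (pderiv (pderiv P)) w)
      (at x)"
  proof -
    have 1: "((\<lambda>y. 4 * s / (1 - 2 * y)) has_field_derivative 8 * s / h\<^sup>2) (at x)"
      using h0 unfolding h_def by (auto intro!: derivative_eq_intros simp: power2_eq_square)
    have 2: "((\<lambda>y. 1 - 2 * y) has_field_derivative - 2) (at x)"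
      by (auto intro!: derivative_eq_intros)
    have eq: "8 * s / h\<^sup>2 * poly P w + - h * poly (pderiv P) w * (4 * s / h)
        - (- 2 * poly (pderiv P) w + - h * poly (pderiv (pderiv P)) w * h)
      = 8 * s / h\<^sup>2 * poly P w - (4 * s - 2) * poly (pderiv P) w
        + h\<^sup>2 * poly (pderiv (pderiv P)) w"
      using h0 by (simp add: algebra_simps power2_eq_square)
    show ?thesis
      unfolding v_def
      by (rule DERIV_cong[OF DERIV_diff[OF DERIV_mult[OF 1 pol] DERIV_mult[OF 2 pol]]])
        (unfold h_def[symmetric] w_def[symmetric], rule eq)
  qed
  have "deriv (deriv u) x = deriv (\<lambda>y. (1 - 2 * y) powr (- 2 * s) * v y) x"
    using du x' by (intro deriv_cong_ev) (auto simp: eventually_nhds intro!: exI[of _ "ball 0 (1/2)"])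
  also have "\<dots> = E * (4 * s / h) * v x + (8 * s / h\<^sup>2 * poly P w
      - (4 * s - 2) * poly (pderiv P) w + h\<^sup>2 * poly (pderiv (pderiv P)) w) * E"
    using DERIV_mult[OF pow[OF x'] dv] unfolding E_def h_def by (rule DERIV_imp_deriv)
  finally have ddu: "deriv (deriv u) x = \<dots>" .
  have du': "deriv u x = E * v x" using du[OF x'] by (simp add: E_def h_def)
  have ux: "u x = E * poly P w" by (simp add: u_def E_def h_def w_def)
  have vx: "v x = 4 * s / h * poly P w - h * poly (pderiv P) w"
    by (simp add: v_def h_def w_def)
  have x0: "x \<noteq> 0" using x by simp
  have x1: "x - 1 \<noteq> 0" using x' by auto
  have w: "w = x * (x - 1)" by (simp add: w_def power2_eq_square algebra_simps)
  have w0: "w \<noteq> 0" using x0 x1 by (simp add: w)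
  have h2: "h\<^sup>2 = 1 + 4 * w" by (simp add: h_def w_def power2_eq_square algebra_simps)
  have x2: "x - 1 / 2 = - h / 2" by (simp add: h_def)
  have c1: "\<gamma> / x + \<gamma> / (x - 1) + (2 * s + 1) / (x - 1 / 2) = - \<gamma> * h / w - 2 * (2 * s + 1) / h"
    unfolding x2 w using x0 x1 h0 by (simp add: divide_simps) (simp add: h_def algebra_simps)
  have c2: "(2 * (\<gamma> + of_nat m) * (2 * \<theta>) * x - 2 * (\<gamma> + of_nat m) * \<theta>) / (x * (x - 1) * (x - 1 / 2))
      = 4 * (\<gamma> + of_nat m) * \<theta> / w"
  proof -
    have "2 * (\<gamma> + of_nat m) * (2 * \<theta>) * x - 2 * (\<gamma> + of_nat m) * \<theta>
        = 4 * (\<gamma> + of_nat m) * \<theta> * (x - 1 / 2)"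
      by (simp add: algebra_simps)
    moreover have "x - 1 / 2 \<noteq> 0" using h0 x2 by auto
    ultimately show ?thesis by (simp add: w)
  qed
  have eps: "2 * (\<gamma> + of_nat m) + 2 * \<theta> + 1 - \<gamma> - \<gamma> = 2 * s + 1"
    by (simp add: s_def algebra_simps)
  have ode: "w * h\<^sup>2 * poly (pderiv (pderiv P)) w
      + (\<gamma> + 4 * (\<gamma> - s + 1) * w) * poly (pderiv P) w
      - 4 * of_nat m * (\<gamma> - \<theta>) * poly P w = 0"
    using heun_factor_ode[OF \<gamma>, of w m "\<gamma> - \<theta>"]
    unfolding P_def s_def h2 by (simp add: algebra_simps)
  have key: "w * (4 * s / h * v x + (8 * s / h\<^sup>2 * poly P w
      - (4 * s - 2) * poly (pderiv P) w + h\<^sup>2 * poly (pderiv (pderiv P)) w)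
      + (- \<gamma> * h / w - 2 * (2 * s + 1) / h) * v x + 4 * (\<gamma> + of_nat m) * \<theta> / w * poly P w) = 0"
    (is "w * ?L = 0")
  proof -
    have "w * ?L = w * h\<^sup>2 * poly (pderiv (pderiv P)) w
        + (\<gamma> * h\<^sup>2 + (4 - 4 * s) * w) * poly (pderiv P) w
        + 4 * ((\<gamma> + of_nat m) * \<theta> - \<gamma> * s) * poly P w"
      unfolding vx using h0 w0 by (simp add: field_simps) (simp add: algebra_simps power2_eq_square power4_eq_xxxx)
    also have "\<dots> = w * h\<^sup>2 * poly (pderiv (pderiv P)) w
      + (\<gamma> + 4 * (\<gamma> - s + 1) * w) * poly (pderiv P) w
      - 4 * of_nat m * (\<gamma> - \<theta>) * poly P w"
      unfolding h2 s_def by (simp add: algebra_simps)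
    finally show ?thesis using ode by simp
  qed
  have "heun_equation (1 / 2) (2 * (\<gamma> + of_nat m) * \<theta>) (2 * (\<gamma> + of_nat m)) (2 * \<theta>) \<gamma> \<gamma> u x"
    unfolding heun_equation_def Let_def eps c1 c2 ddu du' ux
  proof -
    have "E * (4 * s / h) * v x + (8 * s / h\<^sup>2 * poly P w
        - (4 * s - 2) * poly (pderiv P) w + h\<^sup>2 * poly (pderiv (pderiv P)) w) * E
        + (- \<gamma> * h / w - 2 * (2 * s + 1) / h) * (E * v x)
        + 4 * (\<gamma> + of_nat m) * \<theta> / w * (E * poly P w)
      = E * (4 * s / h * v x + (8 * s / h\<^sup>2 * poly P w
      - (4 * s - 2) * poly (pderiv P) w + h\<^sup>2 * poly (pderiv (pderiv P)) w)
      + (- \<gamma> * h / w - 2 * (2 * s + 1) / h) * v x + 4 * (\<gamma> + of_nat m) * \<theta> / w * poly P w)"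
      by (simp only: distrib_left ac_simps)
    then show "E * (4 * s / h) * v x + (8 * s / h\<^sup>2 * poly P w
        - (4 * s - 2) * poly (pderiv P) w + h\<^sup>2 * poly (pderiv (pderiv P)) w) * E
        + (- \<gamma> * h / w - 2 * (2 * s + 1) / h) * (E * v x)
        + 4 * (\<gamma> + of_nat m) * \<theta> / w * (E * poly P w) = 0"
      using key w0 by (metis mult_eq_0_iff)
  qed
  then show ?thesis unfolding u_def s_def P_def .
qed

lemma Hl_symmetric:
  fixes \<gamma> \<theta> :: complex
  assumes \<gamma>: "\<And>k::nat. \<gamma> \<noteq> - of_nat k" and x: "x \<in> ball 0 (1 / 2)"
  shows "Hl (1 / 2) (2 * (\<gamma> + of_nat m) * \<theta>) (2 * (\<gamma> + of_nat m)) (2 * \<theta>) \<gamma> \<gamma> x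
    = (1 - 2 * x) powr (- 2 * (of_nat m + \<theta>)) * poly (heun_factor m (\<gamma> - \<theta>) \<gamma>) (x\<^sup>2 - x)"
proof -
  have r: "min 1 (norm (1 / 2 :: complex)) = 1 / 2"
    by (simp add: norm_divide)
  show ?thesis
  proof (rule Hl_eqI[where a = "1 / 2" and u = "\<lambda>x. (1 - 2 * x) powr (- 2 * (of_nat m + \<theta>))
      * poly (heun_factor m (\<gamma> - \<theta>) \<gamma>) (x\<^sup>2 - x)", OF _ \<gamma>, unfolded r])
    show "(\<lambda>x. (1 - 2 * x) powr (- 2 * (of_nat m + \<theta>))
        * poly (heun_factor m (\<gamma> - \<theta>) \<gamma>) (x\<^sup>2 - x)) holomorphic_on ball 0 (1 / 2)"
      unfolding poly_heun_factor
      by (intro holomorphic_intros) (use one_minus_double_nonpos in auto)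
  next
    show "(1 - 2 * 0) powr (- 2 * (of_nat m + \<theta>)) * poly (heun_factor m (\<gamma> - \<theta>) \<gamma>) (0\<^sup>2 - 0) = 1"
      by (simp add: poly_0_coeff_0 coeff_heun_factor)
  qed (use heun_equation_symmetric[OF \<gamma>] x in auto)
qed

theorem corollary2p6:
  fixes \<gamma> n :: int and \<theta> :: real
  assumes "0 < \<gamma>" and "\<gamma> \<le> n"
  shows "\<forall>\<^sub>F x :: complex in nhds 0.
    Hl (1 / 2) (2 * of_int n * of_real \<theta>) (2 * of_int n) (2 * of_real \<theta>) (of_int \<gamma>) (of_int \<gamma>) x
      = (1 - 2 * x) powr (- 2 * (of_int n - of_int \<gamma> + of_real \<theta>))
        * (\<Sum>k = 0..nat (n - \<gamma>).
             4 ^ k * of_nat (nat (n - \<gamma>) choose k)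
             * (pochhammer (of_int \<gamma> - of_real \<theta>) k / pochhammer (of_int \<gamma>) k)
             * (x\<^sup>2 - x) ^ k)"
proof -
  have \<gamma>: "(of_int \<gamma> :: complex) \<noteq> - of_nat k" for k :: nat
  proof
    assume "(of_int \<gamma> :: complex) = - of_nat k"
    then have "(of_int \<gamma> :: complex) = of_int (- int k)" by simp
    then have "\<gamma> = - int k" by (simp only: of_int_eq_iff)
    with assms show False by simp
  qed
  define m where "m = nat (n - \<gamma>)"
  have "n - \<gamma> = int m" using assms by (simp add: m_def)
  then have "(of_int (n - \<gamma>) :: complex) = of_nat m" by simp
  then have m: "(of_int n :: complex) - of_int \<gamma> = of_nat m" by simp
  then have n: "(of_int n :: complex) = of_int \<gamma> + of_nat m" by (simp add: algebra_simps)
  have "\<forall>\<^sub>F x :: complex in nhds 0. x \<in> ball 0 (1 / 2)"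
    by (intro eventually_nhds_in_open) auto
  then show ?thesis
    unfolding m m_def[symmetric] n
    by eventually_elim (simp only: Hl_symmetric[OF \<gamma>] poly_heun_factor add_diff_cancel_left')
qed

end
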